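(* The class of unit interval graphs and the class of bipartite permutation graphs each admit low rank-width colorings.
   Context: All graphs are finite and simple. A unit interval graph is the intersection graph of a family of intervals on the real line all of the same length. A permutation graph is the intersection graph of line segments whose endpoints lie on two parallel lines; a bipartite permutation graph is a permutation graph that is bipartite. Rank-width: for a graph $G$ and $X\subseteq V(G)$, $\mathrm{cutrk}_G(X)$ is the rank over GF(2) of the adjacency submatrix with rows $X$ and columns $V(G)\setminus X$; a rank-decomposition is a tree with all nodes of degree 1 or 3 whose leaves are in bijection with $V(G)$, an edge $e$ has width $\mathrm{cutrk}_G$ of the vertex set on one side of $e$, and the rank-width is the minimum over rank-decompositions of the maximum edge width ($0$ for graphs with at most one vertex). A class $\mathcal{D}$ of graphs admits low rank-width colorings if there exist functions $N,Q\colon\mathbb{N}\to\mathbb{N}$ such that for all $p\in\mathbb{N}$, every $G\in\mathcal{D}$ can be vertex colored with at most $N(p)$ colors such that the union of any $i\le p$ color classes induces a subgraph of rank-width at most $Q(i)$. *)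

theory Defs
  imports
    "HOL-Analysis.Analysis"
    "HOL-Library.Z2"
    "HOL-Library.Function_Algebras"
    "Graph_Theory.Digraph_Component"
begin

text \<open>
  Finite simple graphs are given by the locale predicate \<^const>\<open>graph\<close>: finite symmetric digraphs
  without loops and parallel arcs, so every undirected edge is a pair of opposite arcs. Adjacency is
  \<open>u \<rightarrow>\<^bsub>G\<^esub> v\<close>, the degree of a vertex is its \<^const>\<open>out_degree\<close>, and \<open>G \<restriction> S\<close> is the subgraph
  induced by \<open>S \<subseteq> verts G\<close>.
\<close>

section \<open>Intersection graphs\<close>

definition intersection_model :: "('a, 'b) pre_digraph \<Rightarrow> ('a \<Rightarrow> 'c set) \<Rightarrow> bool" where
  "intersection_model G S \<longleftrightarrow>
     (\<forall>u\<in>verts G. \<forall>v\<in>verts G. u \<noteq> v \<longrightarrow> (u \<rightarrow>\<^bsub>G\<^esub> v \<longleftrightarrow> S u \<inter> S v \<noteq> {}))"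

text \<open>Intervals are closed; mixing open and closed ones of the same length would enlarge the class.\<close>

definition unit_interval_graph :: "('a, 'b) pre_digraph \<Rightarrow> bool" where
  "unit_interval_graph G \<longleftrightarrow> graph G \<and>
     (\<exists>(l::real) (a::'a \<Rightarrow> real). l > 0 \<and> intersection_model G (\<lambda>v. {a v..a v + l}))"

text \<open>
  The two parallel lines are \<open>{p + t d | t}\<close> and \<open>{q + t d | t}\<close>; they are distinct because \<open>q\<close>
  is not on the first one.
\<close>

definition permutation_graph :: "('a, 'b) pre_digraph \<Rightarrow> bool" where
  "permutation_graph G \<longleftrightarrow> graph G \<and>
     (\<exists>(p::real \<times> real) q d (a::'a \<Rightarrow> real) (b::'a \<Rightarrow> real).
        d \<noteq> 0 \<and> (\<forall>t. q \<noteq> p + t *\<^sub>R d) \<and>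
        intersection_model G (\<lambda>v. closed_segment (p + a v *\<^sub>R d) (q + b v *\<^sub>R d)))"

definition bipartite :: "('a, 'b) pre_digraph \<Rightarrow> bool" where
  "bipartite G \<longleftrightarrow>
     (\<exists>A B. verts G = A \<union> B \<and> A \<inter> B = {} \<and>
        (\<forall>u v. u \<rightarrow>\<^bsub>G\<^esub> v \<longrightarrow> (u \<in> A \<and> v \<in> B) \<or> (u \<in> B \<and> v \<in> A)))"

definition bipartite_permutation_graph :: "('a, 'b) pre_digraph \<Rightarrow> bool" where
  "bipartite_permutation_graph G \<longleftrightarrow> permutation_graph G \<and> bipartite G"

section \<open>Cut-rank\<close>

definition gf2_scale :: "bit \<Rightarrow> ('a \<Rightarrow> bit) \<Rightarrow> 'a \<Rightarrow> bit" where
  "gf2_scale c f = (\<lambda>x. c * f x)"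

global_interpretation gf2: vector_space gf2_scale
  by unfold_locales (auto simp: gf2_scale_def fun_eq_iff algebra_simps)

text \<open>
  The rank over GF(2) of the matrix \<open>M\<close> with row index set \<open>R\<close> and column index set \<open>C\<close>, as the
  dimension of its row space; a row is extended by zero outside \<open>C\<close>.
\<close>

definition gf2_rank :: "'r set \<Rightarrow> 'c set \<Rightarrow> ('r \<Rightarrow> 'c \<Rightarrow> bit) \<Rightarrow> nat" where
  "gf2_rank R C M = gf2.dim ((\<lambda>r c. if c \<in> C then M r c else 0) ` R)"

definition cutrk :: "('a, 'b) pre_digraph \<Rightarrow> 'a set \<Rightarrow> nat" where
  "cutrk G X = gf2_rank X (verts G - X) (\<lambda>u v. of_bool (u \<rightarrow>\<^bsub>G\<^esub> v))"

section \<open>Rank-width\<close>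

text \<open>
  The library predicate \<^const>\<open>tree\<close> does not fit symmetric digraphs, where a single edge already
  yields the directed cycle \<open>u, v, u\<close>; the undirected cycles are the directed ones of length at
  least 3.
\<close>

definition undirected_tree :: "('a, 'b) pre_digraph \<Rightarrow> bool" where
  "undirected_tree T \<longleftrightarrow> graph T \<and> Digraph_Component.connected T \<and>
     \<not> (\<exists>c. pre_digraph.cycle T c \<and> 3 \<le> length c)"

definition leaves :: "('a, 'b) pre_digraph \<Rightarrow> 'a set" where
  "leaves T = {t \<in> verts T. out_degree T t = 1}"

definition rank_decomposition ::
    "('a, 'b) pre_digraph \<Rightarrow> ('t, 'e) pre_digraph \<Rightarrow> ('a \<Rightarrow> 't) \<Rightarrow> bool" where
  "rank_decomposition G T L \<longleftrightarrow> undirected_tree T \<and>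
     (\<forall>t\<in>verts T. out_degree T t = 1 \<or> out_degree T t = 3) \<and>
     bij_betw L (verts G) (leaves T)"

definition del_edge :: "('t, 'e) pre_digraph \<Rightarrow> 'e \<Rightarrow> ('t, 'e) pre_digraph" where
  "del_edge T e =
     T\<lparr>arcs := {f \<in> arcs T. {tail T f, head T f} \<noteq> {tail T e, head T e}}\<rparr>"

definition edge_side ::
    "('a, 'b) pre_digraph \<Rightarrow> ('t, 'e) pre_digraph \<Rightarrow> ('a \<Rightarrow> 't) \<Rightarrow> 'e \<Rightarrow> 'a set" where
  "edge_side G T L e = {x \<in> verts G. tail T e \<rightarrow>\<^sup>*\<^bsub>del_edge T e\<^esub> L x}"

text \<open>
  The two arcs of an edge give its two sides, which have the same cut-rank, so the maximum over all
  arcs is the maximum over all edges.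
\<close>

definition decomposition_width ::
    "('a, 'b) pre_digraph \<Rightarrow> ('t, 'e) pre_digraph \<Rightarrow> ('a \<Rightarrow> 't) \<Rightarrow> nat" where
  "decomposition_width G T L = Max ((\<lambda>e. cutrk G (edge_side G T L e)) ` arcs T)"

text \<open>
  Every finite tree is isomorphic to one with natural numbers as nodes. A finite graph with at least
  two vertices has a rank-decomposition, so the infimum is a minimum.
\<close>

definition rank_width :: "('a, 'b) pre_digraph \<Rightarrow> nat" where
  "rank_width G =
     (if card (verts G) \<le> 1 then 0
      else Inf {decomposition_width G T L | (T :: (nat, nat \<times> nat) pre_digraph) L.
                  rank_decomposition G T L})"

section \<open>Low rank-width colorings\<close>

text \<open>The colorings need not be proper.\<close>

definition admits_low_rank_width_colorings :: "('a, 'b) pre_digraph set \<Rightarrow> bool" where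
  "admits_low_rank_width_colorings D \<longleftrightarrow>
     (\<exists>N Q :: nat \<Rightarrow> nat. \<forall>p. \<forall>G\<in>D. \<exists>c :: 'a \<Rightarrow> nat.
        c ` verts G \<subseteq> {..<N p} \<and>
        (\<forall>I \<subseteq> {..<N p}. card I \<le> p \<longrightarrow>
           rank_width (G \<restriction> {v \<in> verts G. c v \<in> I}) \<le> Q (card I)))"

end

theory Submission
  imports Defs
begin

text \<open>
  Graphs of both classes are given by real numbers \<open>x v\<close> such that two distinct vertices, in the
  bipartite case from different sides, are adjacent iff \<open>\<bar>x u - x v\<bar> \<le> 1\<close>. Colour \<open>v\<close> by \<open>\<lfloor>x v\<rfloor>\<close> modulo
  \<open>p + 1\<close>. At most \<open>p\<close> colours leave out some residue, so the remaining columns (the level sets of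
  \<open>\<lfloor>x v\<rfloor>\<close>) fall into blocks without edges between them, each with one column per colour. Order the
  vertices by block, then by fractional part of \<open>x v\<close>, then by decreasing column. In the cut at an initial
  segment of this order, the nonzero rows all come from the block that is cut, and a nonzero row depends
  only on the colour and the side of its vertex. So every cut has rank at most twice the number of
  colours, and a caterpillar with the leaves in this order is the required decomposition.
\<close>

section \<open>Trees given by a parent function\<close>

text \<open>Letting parents be smaller numbers builds acyclicity into the encoding and makes
  induction on the node available.\<close>

locale parent_tree =
  fixes V :: "nat set" and par :: "nat \<Rightarrow> nat"
  assumes finite_nodes: "finite V" and root_in: "0 \<in> V"
    and par_in: "v \<in> V \<Longrightarrow> v \<noteq> 0 \<Longrightarrow> par v \<in> V"
    and par_less: "v \<in> V \<Longrightarrow> v \<noteq> 0 \<Longrightarrow> par v < v"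
begin

definition T :: "(nat, nat \<times> nat) pre_digraph" where
  "T = \<lparr>verts = V, arcs = (\<Union>v\<in>V - {0}. {(v, par v), (par v, v)}), tail = fst, head = snd\<rparr>"

lemma T_simps [simp]: "verts T = V" "tail T = fst" "head T = snd"
  by (simp_all add: T_def)

lemma arcs_T: "(u, v) \<in> arcs T \<longleftrightarrow>
    u \<in> V \<and> v \<in> V \<and> (u \<noteq> 0 \<and> v = par u \<or> v \<noteq> 0 \<and> u = par v)"
  using par_in by (auto simp: T_def)

lemma adj_T: "u \<rightarrow>\<^bsub>T\<^esub> v \<longleftrightarrow> (u, v) \<in> arcs T"
  by (auto simp: arcs_ends_conv)

lemma graph_T: "graph T"
proof -
  interpret wf_digraph T
    by unfold_locales (use arcs_T in \<open>auto simp: prod_eq_iff\<close>)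
  have "finite (arcs T)" using finite_nodes by (simp add: T_def)
  moreover have "par v \<noteq> v" "v \<noteq> par v" if "v \<in> V" "v \<noteq> 0" for v
    using par_less[OF that] by simp_all
  ultimately interpret digraph T
    by unfold_locales (use finite_nodes in
        \<open>auto simp: arcs_T arc_to_ends_def\<close>)
  show ?thesis
    by (rule graphI) (auto simp: symmetric_def sym_def adj_T arcs_T)
qed

sublocale T: graph T by (rule graph_T)

lemma reaches_root: "v \<in> V \<Longrightarrow> v \<rightarrow>\<^sup>*\<^bsub>T\<^esub> 0"
proof (induction v rule: less_induct)
  case (less v)
  show ?case
  proof (cases "v = 0")
    case False
    then have "v \<rightarrow>\<^bsub>T\<^esub> par v" using less.prems par_in by (simp add: adj_T arcs_T)
    with False less par_in par_less show ?thesis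
      by (blast intro: T.adj_reachable_trans)
  qed (use root_in T.reachable_refl[of 0] in simp)
qed

lemma connected_T: "Digraph_Component.connected T"
proof -
  have "u \<rightarrow>\<^sup>*\<^bsub>T\<^esub> v" if "u \<in> V" "v \<in> V" for u v
    using that reaches_root T.symmetric_reachable' T.reachable_trans by blast
  then show ?thesis
    using root_in by (auto simp: connected_def strongly_connected_def T.reachable_mk_symmetric_eq[OF T.sym_arcs])
qed

text \<open>At the largest node of a cycle both neighbours on the cycle would be its parent.\<close>

lemma no_long_cycle:
  assumes cyc: "pre_digraph.cycle T c" and len: "3 \<le> length c"
  shows False
proof -
  obtain u where walk: "T.awalk u c u" and dist: "distinct (tl (T.awalk_verts u c))" and ne: "c \<noteq> []"
    using cyc by (auto simp: T.cycle_def)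
  have cas: "T.cas u c u" and sub: "set c \<subseteq> arcs T" using walk by (auto simp: T.awalk_def)
  \<comment> \<open>The heads of the arcs are the visited nodes without the starting one, so an arc
    of the cycle is determined by its head.\<close>
  have dh: "distinct (map snd c)"
    using dist ne by (simp add: T.awalk_verts_conv'[OF cas])
  define n where "n = length c"
  have step: "snd (p ! i) = fst (p ! Suc i)" if "T.cas a p b" "Suc i < length p" for a b p i
    using that
  proof (induction p arbitrary: a i)
    case (Cons e p)
    then show ?case by (cases i; cases p) auto
  qed simp
  have closing: "fst (c ! 0) = snd (c ! (n - 1))"
  proof -
    have "snd (last p) = b" if "T.cas a p b" "p \<noteq> []" for a b p
      using that by (induction p arbitrary: a) (auto split: if_splits)
    then have "snd (last c) = u" using cas ne by blast
    moreover have "fst (hd c) = u" using cas ne by (cases c) auto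
    ultimately show ?thesis using ne by (simp add: last_conv_nth hd_conv_nth n_def)
  qed
  define nxt where "nxt i = (if Suc i < n then Suc i else 0)" for i
  have nxt_less: "nxt i < n" for i using len by (auto simp: nxt_def n_def)
  have link: "fst (c ! nxt i) = snd (c ! i)" if "i < n" for i
  proof (cases "Suc i < n")
    case True
    then show ?thesis using step[OF cas, of i] by (simp add: nxt_def n_def)
  next
    case False
    then have "i = n - 1" using that by simp
    then show ?thesis using closing False by (simp add: nxt_def)
  qed
  have "Max (snd ` set c) \<in> snd ` set c" using ne by (intro Max_in) auto
  then obtain e where e: "e \<in> set c" "snd e = Max (snd ` set c)" by auto
  then obtain j where j: "j < n" "c ! j = e" by (auto simp: in_set_conv_nth n_def)
  have top: "snd (c ! i) \<le> snd (c ! j)" if "i < n" for i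
    using that e j by (auto simp: n_def intro!: Max_ge)
  \<comment> \<open>The cyclic predecessor of \<open>j\<close>, whose arc enters the largest node of
    the cycle.\<close>
  define i where "i = (if j = 0 then n - 1 else j - 1)"
  have i: "i < n" "nxt i = j" using j len by (auto simp: i_def nxt_def n_def)
  have parent: "b = par a" if "(a, b) \<in> arcs T \<or> (b, a) \<in> arcs T" "b \<le> a" for a b
    using that par_less by (force simp: arcs_T)
  have arc: "c ! k \<in> arcs T" if "k < n" for k using sub that by (auto simp: n_def)
  have "snd (c ! nxt j) = par (snd (c ! j))"
    using parent[of "snd (c ! j)" "snd (c ! nxt j)"] arc[OF nxt_less, of j] link[OF j(1)] top[OF nxt_less]
    by (metis prod.collapse)
  moreover have "snd (c ! i) = par (snd (c ! j))"
    using parent[of "snd (c ! j)" "snd (c ! i)"] arc[OF j(1)] link[OF i(1)] i top[OF i(1)]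
    by (metis prod.collapse)
  \<comment> \<open>Equal heads force equal indices, but the successor and the predecessor of
    \<open>j\<close> differ on a cycle of length at least 3.\<close>
  ultimately have "nxt j = i"
    using dh nxt_less i(1) by (metis length_map n_def nth_eq_iff_index_eq nth_map)
  then show False using len j(1) by (auto simp: i_def nxt_def n_def split: if_splits)
qed

lemma undirected_tree_T: "undirected_tree T"
  using graph_T connected_T no_long_cycle by (auto simp: undirected_tree_def)

lemma out_degree_T:
  "out_degree T v = card {w. (v, w) \<in> arcs T}"
proof -
  have "out_arcs T v = Pair v ` {w. (v, w) \<in> arcs T}"
    by (auto simp: out_arcs_def)
  then show ?thesis by (simp add: out_degree_def card_image inj_on_def)
qed

text \<open>Within the tree, \<open>S\<close> is the set of descendants of \<open>v\<close>. No
  remaining arc crosses its boundary, while climbing to parents leads from inside \<open>S\<close>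
  to \<open>v\<close> and from outside to the root. Both orientations of \<open>e\<close> are
  covered because the decomposition width ranges over arcs.\<close>

lemma reachable_del_edge:
  assumes v: "v \<in> V" "v \<noteq> 0" and S: "v \<in> S" "0 \<notin> S" "par v \<notin> S"
    and closed: "\<And>w. w \<in> V \<Longrightarrow> w \<noteq> 0 \<Longrightarrow> w \<noteq> v \<Longrightarrow> w \<in> S \<longleftrightarrow> par w \<in> S"
    and e: "e \<in> {(v, par v), (par v, v)}" and y: "y \<in> V"
  shows "v \<rightarrow>\<^sup>*\<^bsub>del_edge T e\<^esub> y \<longleftrightarrow> y \<in> S" "par v \<rightarrow>\<^sup>*\<^bsub>del_edge T e\<^esub> y \<longleftrightarrow> y \<notin> S"
proof -
  let ?D = "del_edge T e"
  have arcs_D: "(a, b) \<in> arcs ?D \<longleftrightarrow> (a, b) \<in> arcs T \<and> {a, b} \<noteq> {v, par v}" for a b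
  proof -
    have "{tail T e, head T e} = {v, par v}" using e by auto
    then show ?thesis by (simp add: del_edge_def)
  qed
  have D_simps: "verts ?D = V" "tail ?D = fst" "head ?D = snd" by (simp_all add: del_edge_def)
  have adj_D: "a \<rightarrow>\<^bsub>?D\<^esub> b \<longleftrightarrow> (a, b) \<in> arcs T \<and> {a, b} \<noteq> {v, par v}" for a b
    unfolding arcs_D[symmetric] by (auto simp: arcs_ends_conv D_simps)
  interpret D: wf_digraph ?D
  proof
    show "tail ?D f \<in> verts ?D" "head ?D f \<in> verts ?D" if "f \<in> arcs ?D" for f
      using that by (cases f; simp add: D_simps arcs_D arcs_T)+
  qed
  have "b \<rightarrow>\<^bsub>?D\<^esub> a" if "a \<rightarrow>\<^bsub>?D\<^esub> b" for a b
  proof -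
    have "(b, a) \<in> arcs T" using that unfolding adj_D arcs_T by blast
    moreover have "{b, a} \<noteq> {v, par v}" using that unfolding adj_D by (simp add: insert_commute)
    ultimately show ?thesis unfolding adj_D by blast
  qed
  then have "symmetric ?D" unfolding symmetric_def by (rule symI)
  then interpret D: sym_digraph ?D by (rule D.sym_digraphI)
  have pv: "par v \<in> V" using v par_in by simp
  have adj_S: "a \<in> S \<longleftrightarrow> b \<in> S" if "a \<rightarrow>\<^bsub>?D\<^esub> b" for a b
  proof -
    have ab: "a \<in> V" "b \<in> V" "a \<noteq> 0 \<and> b = par a \<or> b \<noteq> 0 \<and> a = par b"
      and ne: "{a, b} \<noteq> {v, par v}"
      using that unfolding adj_D arcs_T by blast+
    have "a \<noteq> v" if "b = par a" using ne that by blast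
    moreover have "b \<noteq> v" if "a = par b" using ne that by blast
    ultimately show ?thesis using ab(3) closed[OF ab(1)] closed[OF ab(2)] by blast
  qed
  have reach_S: "a \<in> S \<longleftrightarrow> b \<in> S" if "a \<rightarrow>\<^sup>*\<^bsub>?D\<^esub> b" for a b
    using that
  proof (induction rule: D.reachable_induct)
    case (step x y)
    then show ?case using adj_S by blast
  qed simp
  have ends: "w \<rightarrow>\<^sup>*\<^bsub>?D\<^esub> 0 \<or> w \<rightarrow>\<^sup>*\<^bsub>?D\<^esub> v" if "w \<in> V" for w
    using that
  proof (induction w rule: less_induct)
    case (less w)
    show ?case
    proof (cases "w = 0 \<or> w = v")
      case True
      then show ?thesis using less.prems D.reachable_refl by (metis D_simps(1))
    next
      case False
      \<comment> \<open>As \<open>w\<close> differs from \<open>v\<close>, equality would mean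
        \<open>w = par v\<close> and \<open>par w = v\<close>, although parents are smaller.\<close>
      then have "{w, par w} \<noteq> {v, par v}"
        using par_less[OF v] par_less[OF less.prems] by (metis doubleton_eq_iff not_less_iff_gr_or_eq)
      moreover have "(w, par w) \<in> arcs T"
        using False less.prems par_in[OF less.prems] by (simp add: arcs_T)
      ultimately have "w \<rightarrow>\<^bsub>?D\<^esub> par w" unfolding adj_D by blast
      with False less par_in par_less show ?thesis
        by (meson D.adj_reachable_trans)
    qed
  qed
  have "v \<rightarrow>\<^sup>*\<^bsub>?D\<^esub> w" if "w \<in> V" "w \<in> S" for w
    using ends[OF that(1)] reach_S S that D.symmetric_reachable' by blast
  then show "v \<rightarrow>\<^sup>*\<^bsub>?D\<^esub> y \<longleftrightarrow> y \<in> S" using reach_S S y by blast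
  have zero: "w \<rightarrow>\<^sup>*\<^bsub>?D\<^esub> 0" if "w \<in> V" "w \<notin> S" for w
    using ends[OF that(1)] reach_S S that by blast
  have "par v \<rightarrow>\<^sup>*\<^bsub>?D\<^esub> w" if "w \<in> V" "w \<notin> S" for w
    using zero[OF that] zero[OF pv S(3)] D.symmetric_reachable' D.reachable_trans by blast
  then show "par v \<rightarrow>\<^sup>*\<^bsub>?D\<^esub> y \<longleftrightarrow> y \<notin> S" using reach_S S y by blast
qed

end

section \<open>Rank-width from a linear order\<close>

text \<open>
  The even nodes form the spine. Its two ends are leaves themselves; every inner spine node \<open>2 * i\<close>
  carries the leaf \<open>2 * i + 1\<close>.
\<close>

definition caterpillar_nodes :: "nat \<Rightarrow> nat set" where
  "caterpillar_nodes n = {..2 * n - 2} - {1}"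

definition caterpillar_leaf :: "nat \<Rightarrow> nat \<Rightarrow> nat" where
  "caterpillar_leaf n k = (if k = 0 then 0 else if k = n - 1 then 2 * k else 2 * k + 1)"

text \<open>One formula serves both kinds of node: a pendant leaf \<open>v\<close> hangs at the
  spine node \<open>v - 1\<close>, a later spine node at the preceding one,
  \<open>v - 2\<close>.\<close>

definition caterpillar_parent :: "nat \<Rightarrow> nat" where
  "caterpillar_parent v = 2 * ((v - 1) div 2)"

lemma caterpillar_parent_odd: "odd v \<Longrightarrow> caterpillar_parent v = v - 1"
  by (auto simp: caterpillar_parent_def elim!: oddE)

lemma caterpillar_parent_even: "even v \<Longrightarrow> caterpillar_parent v = v - 2"
  by (cases "v = 0") (auto simp: caterpillar_parent_def elim!: evenE)

lemma even_caterpillar_parent: "even (caterpillar_parent v)"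
  by (simp add: caterpillar_parent_def)

section \<open>The caterpillar tree and the cuts it induces\<close>

locale caterpillar =
  fixes n :: nat
  assumes two_le: "2 \<le> n"
begin

sublocale parent_tree "caterpillar_nodes n" caterpillar_parent
  by unfold_locales (auto simp: caterpillar_nodes_def caterpillar_parent_def)

text \<open>Since node 1 is absent, the end 0 has only the neighbour 2; an inner spine node has
  \<open>v - 2\<close>, \<open>v + 2\<close> and its pendant leaf \<open>v + 1\<close>.\<close>

lemma degrees:
  assumes v: "v \<in> caterpillar_nodes n"
  shows "out_degree T v = (if odd v \<or> v = 0 \<or> v = 2 * n - 2 then 1 else 3)"
proof -
  define m where "m = 2 * n - 2"
  have m: "even m" "2 \<le> m" using two_le by (auto simp: m_def)
  \<comment> \<open>Parity keeps \<open>m - 2\<close> from being the missing node 1.\<close>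
  have "m \<noteq> 3" using m(1) by (cases "m = 3") auto
  define N where "N = {w. (v, w) \<in> arcs T}"
  have mem: "w \<in> N \<longleftrightarrow> w \<le> m \<and> w \<noteq> 1 \<and>
      (v \<noteq> 0 \<and> w = caterpillar_parent v \<or> w \<noteq> 0 \<and> v = caterpillar_parent w)" for w
    unfolding N_def mem_Collect_eq arcs_T using v
    by (auto simp: caterpillar_nodes_def m_def)
  have v_le: "v \<le> m" "v \<noteq> 1" using v by (auto simp: caterpillar_nodes_def m_def)
  note parent = caterpillar_parent_odd caterpillar_parent_even
  consider (odd) "odd v" | (zero) "v = 0" | (last) "v = m" "v \<noteq> 0"
    | (mid) "even v" "v \<noteq> 0" "v \<noteq> m" by blast
  then have "card N = (if odd v \<or> v = 0 \<or> v = m then 1 else 3)"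
  proof cases
    case odd
    have "v \<noteq> caterpillar_parent w" for w using odd even_caterpillar_parent by metis
    then have "N = {v - 1}"
      using odd v_le by (auto simp: mem caterpillar_parent_odd elim!: oddE)
    then show ?thesis using odd by simp
  next
    case zero
    have "w \<in> N \<longleftrightarrow> w = 2" for w
      using zero m by (cases "even w") (auto simp: mem parent)
    then have "N = {2}" by (intro set_eqI) simp
    then show ?thesis using zero by simp
  next
    case last
    have "w \<in> N \<longleftrightarrow> w = v - 2" for w
      using last m \<open>m \<noteq> 3\<close> by (cases "even w") (auto simp: mem parent)
    then have "N = {v - 2}" by (intro set_eqI) simp
    then show ?thesis using last by simp
  next
    case mid
    obtain i j where ij: "v = 2 * i" "m = 2 * j" using mid m by (meson evenE)
    then have "v + 2 \<le> m" using v_le mid by simp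
    moreover have "v - 2 \<noteq> 1" unfolding ij by presburger
    ultimately have "w \<in> N \<longleftrightarrow> w = v - 2 \<or> w = v + 1 \<or> w = v + 2" for w
      using mid by (cases "even w") (auto simp: mem parent)
    then have "N = {v - 2, v + 1, v + 2}" by (intro set_eqI) simp
    moreover have "v - 2 \<noteq> v + 1" "v - 2 \<noteq> v + 2" by arith+
    ultimately show ?thesis using mid by simp
  qed
  then show ?thesis by (simp add: out_degree_T N_def m_def)
qed

lemma leaves_T: "leaves T = {v \<in> caterpillar_nodes n. odd v \<or> v = 0 \<or> v = 2 * n - 2}"
  unfolding leaves_def T_simps by (rule Collect_cong) (simp add: degrees cong: conj_cong)

lemma bij_caterpillar_leaf: "bij_betw (caterpillar_leaf n) {..<n} (leaves T)"
proof (rule bij_betwI')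
  show "caterpillar_leaf n i = caterpillar_leaf n j \<longleftrightarrow> i = j"
    if "i \<in> {..<n}" "j \<in> {..<n}" for i j
    using that unfolding caterpillar_leaf_def by (auto split: if_splits)
  show "caterpillar_leaf n i \<in> leaves T" if "i \<in> {..<n}" for i
    unfolding leaves_T using that two_le by (auto simp: caterpillar_leaf_def caterpillar_nodes_def)
  \<comment> \<open>Position \<open>k\<close> sits at \<open>2 * k\<close> or
    \<open>2 * k + 1\<close>, so halving recovers it.\<close>
  show "\<exists>i\<in>{..<n}. v = caterpillar_leaf n i" if "v \<in> leaves T" for v
    using that[unfolded leaves_T] two_le
    by (intro bexI[of _ "v div 2"])
      (auto simp: caterpillar_leaf_def caterpillar_nodes_def elim!: oddE)
qed

lemma rank_decomposition_T:
  assumes "bij_betw pos (verts G) {..<n}"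
  shows "rank_decomposition G T (caterpillar_leaf n \<circ> pos)"
  using undirected_tree_T bij_betw_trans[OF assms bij_caterpillar_leaf]
  by (simp add: rank_decomposition_def degrees)

text \<open>An odd node is never a parent, so its only descendant is itself.\<close>

lemma reachable_odd:
  assumes v: "v \<in> caterpillar_nodes n" "odd v" and y: "y \<in> caterpillar_nodes n"
    and e: "e \<in> {(v, caterpillar_parent v), (caterpillar_parent v, v)}"
  shows "v \<rightarrow>\<^sup>*\<^bsub>del_edge T e\<^esub> y \<longleftrightarrow> y = v" "caterpillar_parent v \<rightarrow>\<^sup>*\<^bsub>del_edge T e\<^esub> y \<longleftrightarrow> y \<noteq> v"
proof -
  have ne: "caterpillar_parent w \<noteq> v" for w using v even_caterpillar_parent by metis
  have "v \<noteq> 0" using v by (cases "v = 0") auto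
  from reachable_del_edge[OF v(1) this, of "{v}", OF _ _ _ _ e y] this ne
  show "v \<rightarrow>\<^sup>*\<^bsub>del_edge T e\<^esub> y \<longleftrightarrow> y = v" "caterpillar_parent v \<rightarrow>\<^sup>*\<^bsub>del_edge T e\<^esub> y \<longleftrightarrow> y \<noteq> v"
    by simp_all
qed

text \<open>Numbers increase along the spine, so the descendants of \<open>v\<close> are the nodes
  from \<open>v\<close> upwards, pendant leaves included.\<close>

lemma reachable_even:
  assumes v: "v \<in> caterpillar_nodes n" "even v" "v \<noteq> 0" and y: "y \<in> caterpillar_nodes n"
    and e: "e \<in> {(v, caterpillar_parent v), (caterpillar_parent v, v)}"
  shows "v \<rightarrow>\<^sup>*\<^bsub>del_edge T e\<^esub> y \<longleftrightarrow> v \<le> y" "caterpillar_parent v \<rightarrow>\<^sup>*\<^bsub>del_edge T e\<^esub> y \<longleftrightarrow> y < v"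
proof -
  have le: "v \<le> caterpillar_parent w \<longleftrightarrow> v \<le> w" if "w \<noteq> v" for w
    using v that by (cases "even w") (auto simp: caterpillar_parent_odd caterpillar_parent_even elim!: evenE)
  have lt: "caterpillar_parent v < v" using v par_less by simp
  show "v \<rightarrow>\<^sup>*\<^bsub>del_edge T e\<^esub> y \<longleftrightarrow> v \<le> y" "caterpillar_parent v \<rightarrow>\<^sup>*\<^bsub>del_edge T e\<^esub> y \<longleftrightarrow> y < v"
    using reachable_del_edge[OF v(1,3), of "{v..}", OF _ _ _ _ e y] le lt v by (simp_all add: not_le)
qed

text \<open>An edge to a pendant leaf cuts off one position, an edge of the spine an initial
  segment. Each cut occurs from both sides, because \<open>edge_side\<close> takes the side of the
  tail of the arc.\<close>

lemma edge_sides: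
  assumes pos: "bij_betw pos (verts G) {..<n}" and e: "e \<in> arcs T"
  obtains (prefix) k where "edge_side G T (caterpillar_leaf n \<circ> pos) e = {x \<in> verts G. pos x < k}"
  | (suffix) k where "edge_side G T (caterpillar_leaf n \<circ> pos) e = {x \<in> verts G. k \<le> pos x}"
  | (single) k where "edge_side G T (caterpillar_leaf n \<circ> pos) e = {x \<in> verts G. pos x = k}"
  | (cosingle) k where "edge_side G T (caterpillar_leaf n \<circ> pos) e = {x \<in> verts G. pos x \<noteq> k}"
proof -
  obtain v where v: "v \<in> caterpillar_nodes n" "v \<noteq> 0"
    and ev: "e \<in> {(v, caterpillar_parent v), (caterpillar_parent v, v)}"
    using e by (cases e) (auto simp: arcs_T)
  then have v_le: "v \<le> 2 * n - 2" "v \<noteq> 1" by (auto simp: caterpillar_nodes_def)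
  have pos_less: "pos x < n" if "x \<in> verts G" for x
    using pos that by (auto simp: bij_betw_def)
  have L_in: "caterpillar_leaf n (pos x) \<in> caterpillar_nodes n" if "x \<in> verts G" for x
    using bij_caterpillar_leaf pos_less[OF that] by (auto simp: bij_betw_def leaves_T)
  show thesis
  proof (cases "odd v")
    case True
    have L: "caterpillar_leaf n (pos x) = v \<longleftrightarrow> pos x = v div 2" if "x \<in> verts G" for x
      using v_le True pos_less[OF that] by (auto simp: caterpillar_leaf_def elim!: oddE)
    note reach = reachable_odd[OF v(1) True L_in ev]
    from ev consider "tail T e = v" | "tail T e = caterpillar_parent v" by auto
    then show thesis
      using single[of "v div 2"] cosingle[of "v div 2"]
      by cases (simp_all only: edge_side_def comp_apply reach L cong: conj_cong)
  next
    case False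
    have L: "v \<le> caterpillar_leaf n (pos x) \<longleftrightarrow> v div 2 \<le> pos x"
        "caterpillar_leaf n (pos x) < v \<longleftrightarrow> pos x < v div 2" if "x \<in> verts G" for x
      using v_le False pos_less[OF that] by (auto simp: caterpillar_leaf_def elim!: evenE)
    note reach = reachable_even[OF v(1) _ v(2) L_in ev]
    from ev consider "tail T e = v" | "tail T e = caterpillar_parent v" by auto
    then show thesis
      using prefix[of "v div 2"] suffix[of "v div 2"] False
      by cases (simp_all only: edge_side_def comp_apply reach L not_not cong: conj_cong)
  qed
qed

end

section \<open>Bounds on the cut-rank and on linear rank-width\<close>

text \<open>Hypothesis \<open>rows\<close>, applied in both directions, makes nonzero rows with the
  same label equal, so one representative per label spans the row space. The neighbours
  \<open>z\<close> and \<open>z'\<close> outside \<open>X\<close> witness that the rows are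
  nonzero.\<close>

lemma cutrk_le_card:
  fixes G :: "('a, 'b) pre_digraph"
  assumes K: "finite K" "f ` X \<subseteq> K"
    and rows: "\<And>x y y' z z'. \<lbrakk>x \<in> X; y \<in> X; f x = f y; z \<in> verts G - X; z' \<in> verts G - X;
      x \<rightarrow>\<^bsub>G\<^esub> z; y \<rightarrow>\<^bsub>G\<^esub> z'\<rbrakk> \<Longrightarrow> y \<rightarrow>\<^bsub>G\<^esub> z"
  shows "cutrk G X \<le> card K"
proof -
  define row where "row x z = (if z \<in> verts G - X then of_bool (x \<rightarrow>\<^bsub>G\<^esub> z) else (0::bit))" for x z
  \<comment> \<open>For a label without a nonzero row \<open>SOME\<close> yields an arbitrary
    vertex; this does no harm, since the rows only have to lie in the span.\<close>
  define g where "g k = row (SOME x. x \<in> X \<and> f x = k \<and> row x \<noteq> 0)" for k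
  have "row x \<in> gf2.span (g ` K)" if x: "x \<in> X" for x
  proof (cases "row x = 0")
    case False
    define y where "y = (SOME y. y \<in> X \<and> f y = f x \<and> row y \<noteq> 0)"
    have y: "y \<in> X" "f y = f x" "row y \<noteq> 0"
      using someI[of "\<lambda>y. y \<in> X \<and> f y = f x \<and> row y \<noteq> 0" x] x False by (auto simp: y_def)
    obtain a where a: "a \<in> verts G - X" "x \<rightarrow>\<^bsub>G\<^esub> a"
      using False by (auto simp: row_def fun_eq_iff split: if_splits)
    obtain b where b: "b \<in> verts G - X" "y \<rightarrow>\<^bsub>G\<^esub> b"
      using y(3) by (auto simp: row_def fun_eq_iff split: if_splits)
    have "x \<rightarrow>\<^bsub>G\<^esub> z \<longleftrightarrow> y \<rightarrow>\<^bsub>G\<^esub> z" if "z \<in> verts G - X" for z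
      using rows[of x y z b] rows[of y x z a] x y a b that by auto
    then have "row x = row y" by (auto simp: row_def fun_eq_iff)
    then have "row x = g (f x)" by (simp add: g_def y_def)
    then show ?thesis using K x by (auto intro: gf2.span_base)
  qed (simp add: gf2.span_zero)
  then have "gf2.dim (row ` X) \<le> card (g ` K)"
    using K by (intro gf2.dim_le_card) auto
  also have "\<dots> \<le> card K" using K by (intro card_image_le)
  finally show ?thesis by (simp add: cutrk_def gf2_rank_def row_def[abs_def])
qed

lemma cutrk_singleton: "cutrk G {x} \<le> 1"
  using cutrk_le_card[of "{()}" "\<lambda>_. ()" "{x}" G] by auto

text \<open>Only the column of \<open>x\<close> can remain, so any two nonzero rows agree.\<close>

lemma cutrk_cosingleton: "cutrk G (verts G - {x}) \<le> 1"
proof -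
  have "cutrk G (verts G - {x}) \<le> card {()}"
    by (rule cutrk_le_card[where f = "\<lambda>_. ()"]) auto
  then show ?thesis by simp
qed

text \<open>The witness is the caterpillar whose leaves follow \<open>pos\<close>. Its spine edges
  give the two assumed kinds of cut; its pendant edges have cut-rank at most 1, which the positivity
  of \<open>w\<close> absorbs.\<close>

lemma rank_width_le_linear:
  fixes G :: "('a, 'b) pre_digraph"
  assumes pos: "bij_betw pos (verts G) {..<card (verts G)}" and w: "1 \<le> w"
    and prefix: "\<And>k. cutrk G {x \<in> verts G. pos x < k} \<le> w"
    and suffix: "\<And>k. cutrk G {x \<in> verts G. k \<le> pos x} \<le> w"
  shows "rank_width G \<le> w"
proof (cases "card (verts G) \<le> 1")
  case False
  interpret caterpillar "card (verts G)" using False by unfold_locales simp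
  let ?L = "caterpillar_leaf (card (verts G)) \<circ> pos"
  have width: "cutrk G (edge_side G T ?L e) \<le> w" if e: "e \<in> arcs T" for e
  proof -
    have level: "cutrk G {x \<in> verts G. pos x = k} \<le> w \<and> cutrk G {x \<in> verts G. pos x \<noteq> k} \<le> w" for k
    proof (cases "\<exists>y\<in>verts G. pos y = k")
      case True
      then obtain y where "y \<in> verts G" "pos y = k" by blast
      then have eq: "{x \<in> verts G. pos x = k} = {y}" "{x \<in> verts G. pos x \<noteq> k} = verts G - {y}"
        using pos by (auto simp: bij_betw_def inj_on_def)
      show ?thesis
        unfolding eq by (intro conjI order_trans[OF cutrk_singleton w] order_trans[OF cutrk_cosingleton w])
    next
      \<comment> \<open>A value \<open>k\<close> that is not taken leaves the empty set and the
        whole vertex set, which are the trivial initial and final segments.\<close>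
      case False
      then have eq: "{x \<in> verts G. pos x = k} = {}" "{x \<in> verts G. pos x \<noteq> k} = verts G" by auto
      show ?thesis unfolding eq using prefix[of 0] suffix[of 0] by simp
    qed
    show ?thesis using pos e
      by (cases rule: edge_sides) (simp_all only: prefix suffix level)
  qed
  \<comment> \<open>\<open>Max\<close> in the decomposition width is meaningful only for a nonempty
    set of arcs.\<close>
  have ne: "arcs T \<noteq> {}"
  proof -
    have "2 \<in> caterpillar_nodes (card (verts G))" using two_le by (simp add: caterpillar_nodes_def)
    then have "(2, 0) \<in> arcs T" using root_in by (simp add: arcs_T caterpillar_parent_def)
    then show ?thesis by blast
  qed
  have "rank_width G \<le> decomposition_width G T ?L"
    using False rank_decomposition_T[OF pos]
    by (auto simp: rank_width_def intro!: cInf_lower)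
  also have "\<dots> \<le> w"
    using width ne T.finite_arcs by (auto simp: decomposition_width_def)
  finally show ?thesis .
qed (simp add: rank_width_def)

section \<open>Distance graphs on the real line\<close>

text \<open>Elements are inserted by nondecreasing key, each taking the next free position; ties are
  broken arbitrarily.\<close>

lemma linear_extension:
  fixes k :: "'a \<Rightarrow> 'b::linorder"
  assumes "finite V"
  obtains pos where "bij_betw pos V {..<card V}" "\<And>u v. u \<in> V \<Longrightarrow> v \<in> V \<Longrightarrow> k u < k v \<Longrightarrow> pos u < pos v"
proof -
  have "\<exists>pos. bij_betw pos V {..<card V} \<and> (\<forall>u\<in>V. \<forall>v\<in>V. k u < k v \<longrightarrow> pos u < pos v)"
    using assms
  proof (induction rule: finite_ranking_induct[where f = k])
    case empty
    then show ?case by (auto simp: bij_betw_def)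
  next
    case (insert x S)
    show ?case
    proof (cases "x \<in> S")
      case True
      then show ?thesis using insert.IH by (simp add: insert_absorb)
    next
      case False
      obtain pos where pos: "bij_betw pos S {..<card S}" "\<forall>u\<in>S. \<forall>v\<in>S. k u < k v \<longrightarrow> pos u < pos v"
        using insert.IH by blast
      let ?pos = "pos(x := card S)"
      have "bij_betw ?pos S {..<card S}"
        using pos(1) False by (subst bij_betw_cong[where g = pos]) auto
      then have "bij_betw ?pos (insert x S) (insert (card S) {..<card S})"
        using notIn_Un_bij_betw[of x S ?pos "{..<card S}"] False by simp
      then have "bij_betw ?pos (insert x S) {..<card (insert x S)}"
        using insert.hyps False by (simp add: lessThan_Suc)
      moreover have "?pos u < ?pos v" if uv: "u \<in> insert x S" "v \<in> insert x S" "k u < k v" for u v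
      proof -
        have "u \<noteq> x" using uv insert.hyps by (metis insertE less_irrefl not_less)
        then have "u \<in> S" using uv by simp
        moreover from this have "pos u < card S" using pos(1) by (auto simp: bij_betw_def)
        ultimately show ?thesis using uv pos(2) \<open>u \<noteq> x\<close> by auto
      qed
      ultimately show ?thesis by blast
    qed
  qed
  then show thesis using that by blast
qed

text \<open>Counting predecessors turns the partial order into a numeric key. The key grows strictly
  from \<open>u\<close> to \<open>v\<close>, since \<open>u\<close> precedes \<open>v\<close> but
  not itself.\<close>

lemma linear_extension_order:
  assumes "finite V" and irrefl: "\<And>u. u \<in> V \<Longrightarrow> \<not> lt u u"
    and trans: "\<And>u v w. \<lbrakk>u \<in> V; v \<in> V; w \<in> V; lt u v; lt v w\<rbrakk> \<Longrightarrow> lt u w"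
  obtains pos where "bij_betw pos V {..<card V}" "\<And>u v. u \<in> V \<Longrightarrow> v \<in> V \<Longrightarrow> lt u v \<Longrightarrow> pos u < (pos v :: nat)"
proof -
  define k where "k v = card {u \<in> V. lt u v}" for v
  obtain pos where pos: "bij_betw pos V {..<card V}"
    "\<And>u v. u \<in> V \<Longrightarrow> v \<in> V \<Longrightarrow> k u < k v \<Longrightarrow> pos u < pos v"
    using linear_extension[OF \<open>finite V\<close>, of k] by blast
  have "k u < k v" if "u \<in> V" "v \<in> V" "lt u v" for u v
    unfolding k_def
  proof (rule psubset_card_mono)
    show "finite {u \<in> V. lt u v}" using \<open>finite V\<close> by simp
    show "{w \<in> V. lt w u} \<subset> {w \<in> V. lt w v}" using that irrefl trans by blast
  qed
  with pos that show thesis by blast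
qed

section \<open>Cuts and colorings of distance graphs\<close>

text \<open>Here residue 0 is the absent colour, so the blocks are the quotients of the columns by
  \<open>q\<close>. Rows are labelled by residue and side, and the two sides give the factor 2. The
  relation \<open>joins\<close> says which sides may be adjacent, so that both graph classes
  fit.\<close>

lemma rank_width_le_distance_graph:
  fixes H :: "('a, 'b) pre_digraph" and x :: "'a \<Rightarrow> real" and s :: "'a \<Rightarrow> bool" and q :: int
  assumes fin: "finite (verts H)"
    and adj: "\<And>u v. u \<in> verts H \<Longrightarrow> v \<in> verts H \<Longrightarrow>
      u \<rightarrow>\<^bsub>H\<^esub> v \<longleftrightarrow> u \<noteq> v \<and> joins (s u) (s v) \<and> \<bar>x u - x v\<bar> \<le> 1"
    and q: "q > 0" and K: "finite K" "0 \<notin> K" "\<And>v. v \<in> verts H \<Longrightarrow> \<lfloor>x v\<rfloor> mod q \<in> K"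
  shows "rank_width H \<le> 2 * card K"
proof (cases "verts H = {}")
  case True
  then show ?thesis by (simp add: rank_width_def)
next
  case False
  define col where "col v = \<lfloor>x v\<rfloor>" for v
  define bl where "bl v = col v div q" for v
  define fr where "fr v = x v - of_int (col v)" for v
  \<comment> \<open>Two vertices in consecutive columns of one block are at distance at most 1
    exactly when the one in the higher column comes first; the tie-break settles distance exactly
    1.\<close>
  define lt where "lt u v \<longleftrightarrow> bl u < bl v \<or> bl u = bl v \<and> (fr u < fr v \<or> fr u = fr v \<and> col v < col u)" for u v
  have x_eq: "x v = of_int (col v) + fr v" for v by (simp add: fr_def)
  have fr: "0 \<le> fr v" "fr v < 1" for v unfolding fr_def col_def by linarith+
  have col_mod: "col v mod q \<in> K" if "v \<in> verts H" for v using K(3)[OF that] by (simp add: col_def)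
  \<comment> \<open>A block boundary lies just before a column of residue 0, and such columns are
    empty.\<close>
  have block_Suc: "(c + 1) div q = c div q" if "(c + 1) mod q \<in> K" for c :: int
  proof (rule int_div_pos_eq)
    show "c + 1 = q * (c div q) + (c mod q + 1)" by simp
    show "0 \<le> c mod q + 1" using q by simp
    have "(c mod q + 1) mod q \<noteq> 0" using that K(2) by (metis mod_add_left_eq)
    then show "c mod q + 1 < q"
      using pos_mod_bound[OF q, of c] by (cases "c mod q + 1 = q") auto
  qed
  have near: "bl u = bl v \<and> (col v = col u \<or> col v = col u + 1 \<or> col u = col v + 1)"
    if uv: "u \<in> verts H" "v \<in> verts H" "u \<rightarrow>\<^bsub>H\<^esub> v" for u v
  proof -
    have "\<bar>x u - x v\<bar> \<le> 1" using adj uv by blast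
    then have "col v = col u \<or> col v = col u + 1 \<or> col u = col v + 1"
      using fr[of u] fr[of v] unfolding x_eq by linarith
    then show ?thesis
      using block_Suc[of "col u"] block_Suc[of "col v"] col_mod[OF uv(1)] col_mod[OF uv(2)] by (auto simp: bl_def)
  qed
  \<comment> \<open>The two alternatives describe initial and final segments of the order.\<close>
  have cut: "cutrk H X \<le> 2 * card K"
    if X: "X \<subseteq> verts H" and
      sep: "(\<forall>u\<in>X. \<forall>w\<in>verts H - X. \<not> lt w u) \<or> (\<forall>u\<in>X. \<forall>w\<in>verts H - X. \<not> lt u w)" for X
  proof -
    have "cutrk H X \<le> card (K \<times> (UNIV :: bool set))"
    proof (rule cutrk_le_card[where f = "\<lambda>v. (col v mod q, s v)"])
      fix u v w w'
      assume u: "u \<in> X" and v: "v \<in> X" and w: "w \<in> verts H - X" and w': "w' \<in> verts H - X"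
        and eq: "(col u mod q, s u) = (col v mod q, s v)"
        and uw: "u \<rightarrow>\<^bsub>H\<^esub> w" and vw': "v \<rightarrow>\<^bsub>H\<^esub> w'"
      have in_H: "u \<in> verts H" "v \<in> verts H" "w \<in> verts H" "w' \<in> verts H" using u v w w' X by auto
      have near_uw: "bl u = bl w" "col w = col u \<or> col w = col u + 1 \<or> col u = col w + 1"
        using near[OF _ _ uw] in_H by blast+
      have near_vw': "bl v = bl w'" using near[OF _ _ vw'] in_H by blast
      have not_lt: "\<not> lt w v \<and> \<not> lt w u \<and> \<not> lt w' u \<or> \<not> lt v w \<and> \<not> lt u w \<and> \<not> lt u w'"
        using sep u v w w' by blast
      \<comment> \<open>Both edges stay inside a block and cross the cut, and only one block can be
        cut.\<close>
      then have bl: "bl u = bl v" using near_uw(1) near_vw' by (auto simp: lt_def)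
      then have col: "col u = col v" using eq unfolding bl_def by (metis div_mult_mod_eq prod.inject)
      have "\<bar>x u - x w\<bar> \<le> 1" "joins (s u) (s w)" using adj in_H uw by blast+
      \<comment> \<open>Now \<open>u\<close> and \<open>v\<close> share a column and lie on the same
        side of \<open>w\<close> in the order, so by the choice of \<open>lt\<close> both or neither
        are within distance 1 of \<open>w\<close>.\<close>
      then have "\<bar>x v - x w\<bar> \<le> 1"
        using near_uw not_lt bl col fr[of u] fr[of v] fr[of w] unfolding x_eq lt_def by auto
      then show "v \<rightarrow>\<^bsub>H\<^esub> w" using adj in_H eq \<open>joins (s u) (s w)\<close> v w by auto
    qed (use K col_mod X in auto)
    then show ?thesis using K(1) by (simp add: card_cartesian_product)
  qed
  obtain pos where pos: "bij_betw pos (verts H) {..<card (verts H)}"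
    and pos_less: "\<And>u v. u \<in> verts H \<Longrightarrow> v \<in> verts H \<Longrightarrow> lt u v \<Longrightarrow> pos u < pos v"
  proof (rule linear_extension_order[OF fin, of lt])
    show "\<not> lt u u" for u by (simp add: lt_def)
    show "lt u w" if "lt u v" "lt v w" for u v w using that unfolding lt_def by linarith
  qed blast
  show ?thesis
  proof (rule rank_width_le_linear[OF pos])
    have "K \<noteq> {}" using False K(3) by blast
    then show "1 \<le> 2 * card K" using K(1) card_gt_0_iff[of K] by linarith
    fix k
    have "\<not> lt w u" if "u \<in> verts H" "w \<in> verts H" "pos u < k" "\<not> pos w < k" for u w
      using pos_less[OF that(2,1)] that by linarith
    then have "\<forall>u\<in>{v \<in> verts H. pos v < k}. \<forall>w\<in>verts H - {v \<in> verts H. pos v < k}. \<not> lt w u"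
      by blast
    then show "cutrk H {v \<in> verts H. pos v < k} \<le> 2 * card K" by (intro cut disjI1) blast
    have "\<not> lt u w" if "u \<in> verts H" "w \<in> verts H" "k \<le> pos u" "\<not> k \<le> pos w" for u w
      using pos_less[OF that(1,2)] that by linarith
    then have "\<forall>u\<in>{v \<in> verts H. k \<le> pos v}. \<forall>w\<in>verts H - {v \<in> verts H. k \<le> pos v}. \<not> lt u w"
      by blast
    then show "cutrk H {v \<in> verts H. k \<le> pos v} \<le> 2 * card K" by (intro cut disjI2) blast
  qed
qed

text \<open>Some colour \<open>m\<close> among the \<open>p + 1\<close> is missing from
  \<open>I\<close>. Translating by \<open>m\<close> keeps all distances and makes 0 the missing
  residue.\<close>

lemma rank_width_induce_distance_graph:
  fixes G :: "('a, 'b) pre_digraph" and x :: "'a \<Rightarrow> real" and s :: "'a \<Rightarrow> bool"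
  assumes fin: "finite (verts G)"
    and adj: "\<And>u v. u \<in> verts G \<Longrightarrow> v \<in> verts G \<Longrightarrow>
      u \<rightarrow>\<^bsub>G\<^esub> v \<longleftrightarrow> u \<noteq> v \<and> joins (s u) (s v) \<and> \<bar>x u - x v\<bar> \<le> 1"
    and I: "I \<subseteq> {..<Suc p}" "card I \<le> p"
  shows "rank_width (G \<restriction> {v \<in> verts G. nat (\<lfloor>x v\<rfloor> mod (int p + 1)) \<in> I}) \<le> 2 * card I"
proof -
  let ?q = "int p + 1" and ?S = "{v \<in> verts G. nat (\<lfloor>x v\<rfloor> mod (int p + 1)) \<in> I}"
  have "finite I" using I(1) by (rule finite_subset) simp
  have "I \<noteq> {..<Suc p}" using I(2) by auto
  then obtain m where m: "m \<le> p" "m \<notin> I" using I(1) by (metis less_Suc_eq_le lessThan_iff subset_antisym subsetI)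
  define y where "y v = x v - of_int (int m)" for v
  define K where "K = (\<lambda>i. (int i - int m) mod ?q) ` I"
  have "rank_width (G \<restriction> ?S) \<le> 2 * card K"
  proof (rule rank_width_le_distance_graph[where x = y and s = s and joins = joins and q = ?q])
    show "u \<rightarrow>\<^bsub>G \<restriction> ?S\<^esub> v \<longleftrightarrow> u \<noteq> v \<and> joins (s u) (s v) \<and> \<bar>y u - y v\<bar> \<le> 1"
      if uv: "u \<in> verts (G \<restriction> ?S)" "v \<in> verts (G \<restriction> ?S)" for u v
    proof -
      have "u \<rightarrow>\<^bsub>G \<restriction> ?S\<^esub> v \<longleftrightarrow> u \<rightarrow>\<^bsub>G\<^esub> v"
        using uv by (auto simp: arcs_ends_conv induce_subgraph_def)
      then show ?thesis using adj[of u v] uv by (simp add: y_def)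
    qed
    show "0 \<notin> K"
    proof
      assume "0 \<in> K"
      then obtain i where i: "i \<in> I" "(int i - int m) mod ?q = 0" unfolding K_def by force
      then have "int i mod ?q = int m mod ?q" by (simp add: mod_eq_dvd_iff dvd_eq_mod_eq_0)
      moreover have "i \<le> p" using i(1) I(1) by auto
      ultimately show False using m i(1) by simp
    qed
    show "\<lfloor>y v\<rfloor> mod ?q \<in> K" if "v \<in> verts (G \<restriction> ?S)" for v
    proof -
      have "nat (\<lfloor>x v\<rfloor> mod ?q) \<in> I" using that by simp
      moreover have "\<lfloor>y v\<rfloor> mod ?q = (int (nat (\<lfloor>x v\<rfloor> mod ?q)) - int m) mod ?q"
        unfolding y_def floor_diff_of_int by (simp add: mod_diff_left_eq)
      ultimately show ?thesis unfolding K_def by blast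
    qed
  qed (use fin \<open>finite I\<close> in \<open>simp_all add: K_def\<close>)
  also have "\<dots> \<le> 2 * card I" unfolding K_def using card_image_le[OF \<open>finite I\<close>] by simp
  finally show ?thesis .
qed

lemma admits_low_rank_width_colorings_distance_graphs:
  fixes D :: "('a, 'b) pre_digraph set"
  assumes "\<And>G. G \<in> D \<Longrightarrow> finite (verts G) \<and> (\<exists>(x :: 'a \<Rightarrow> real) (s :: 'a \<Rightarrow> bool) joins.
      \<forall>u\<in>verts G. \<forall>v\<in>verts G.
        u \<rightarrow>\<^bsub>G\<^esub> v \<longleftrightarrow> u \<noteq> v \<and> joins (s u) (s v) \<and> \<bar>x u - x v\<bar> \<le> 1)"
  shows "admits_low_rank_width_colorings D"
  unfolding admits_low_rank_width_colorings_def
\<comment> \<open>With \<open>p + 1\<close> colours any \<open>p\<close> of them miss one; the bound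
  \<open>2 * i\<close> does not depend on \<open>p\<close>.\<close>
proof (rule exI[of _ Suc], rule exI[of _ "\<lambda>i. 2 * i"], intro allI ballI)
  fix p and G
  assume "G \<in> D"
  then obtain x :: "'a \<Rightarrow> real" and s :: "'a \<Rightarrow> bool" and joins where fin: "finite (verts G)"
    and adj: "\<And>u v. u \<in> verts G \<Longrightarrow> v \<in> verts G \<Longrightarrow>
      u \<rightarrow>\<^bsub>G\<^esub> v \<longleftrightarrow> u \<noteq> v \<and> joins (s u) (s v) \<and> \<bar>x u - x v\<bar> \<le> 1"
    using assms[of G] by auto
  show "\<exists>c :: 'a \<Rightarrow> nat. c ` verts G \<subseteq> {..<Suc p} \<and>
      (\<forall>I \<subseteq> {..<Suc p}. card I \<le> p \<longrightarrow> rank_width (G \<restriction> {v \<in> verts G. c v \<in> I}) \<le> 2 * card I)"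
  proof (intro exI conjI allI impI)
    show "(\<lambda>v. nat (\<lfloor>x v\<rfloor> mod (int p + 1))) ` verts G \<subseteq> {..<Suc p}"
      using pos_mod_bound[of "int p + 1"] by (auto simp: nat_less_iff add.commute)
    show "rank_width (G \<restriction> {v \<in> verts G. nat (\<lfloor>x v\<rfloor> mod (int p + 1)) \<in> I}) \<le> 2 * card I"
      if "I \<subseteq> {..<Suc p}" "card I \<le> p" for I
      using rank_width_induce_distance_graph[OF fin adj that] .
  qed
qed

text \<open>Closed intervals of length \<open>l\<close> meet iff their left endpoints are at most
  \<open>l\<close> apart, so the left endpoints divided by \<open>l\<close> give the
  embedding.\<close>

lemma unit_interval_graph_distance:
  fixes G :: "('a, 'b) pre_digraph"
  assumes "unit_interval_graph G"
  shows "\<exists>x :: 'a \<Rightarrow> real. \<forall>u\<in>verts G. \<forall>v\<in>verts G. u \<rightarrow>\<^bsub>G\<^esub> v \<longleftrightarrow> u \<noteq> v \<and> \<bar>x u - x v\<bar> \<le> 1"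
proof -
  obtain l :: real and a where l: "l > 0" and G: "graph G"
    and model: "intersection_model G (\<lambda>v. {a v..a v + l})"
    using assms by (auto simp: unit_interval_graph_def)
  interpret graph G by (rule G)
  have "u \<rightarrow>\<^bsub>G\<^esub> v \<longleftrightarrow> u \<noteq> v \<and> \<bar>a u / l - a v / l\<bar> \<le> 1" if uv: "u \<in> verts G" "v \<in> verts G" for u v
  proof (cases "u = v")
    case False
    have "u \<rightarrow>\<^bsub>G\<^esub> v \<longleftrightarrow> {a u..a u + l} \<inter> {a v..a v + l} \<noteq> {}"
      using model uv False by (simp add: intersection_model_def)
    also have "\<dots> \<longleftrightarrow> \<bar>a u - a v\<bar> \<le> l"
      using l by (auto simp: abs_le_iff)
    also have "\<dots> \<longleftrightarrow> \<bar>(a u - a v) / l\<bar> \<le> 1" using l by (simp add: abs_divide)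
    finally show ?thesis using False by (simp add: diff_divide_distrib)
  qed (auto dest: adj_not_same)
  then show ?thesis by (intro exI[of _ "\<lambda>v. a v / l"] ballI)
qed

section \<open>Bipartite permutation graphs as distance graphs\<close>

text \<open>Provides the next value of a greedily built embedding, with \<open>L\<close> and
  \<open>U\<close> the lower and upper bounds on it. Either set of bounds may be empty.\<close>

lemma finite_sets_separation:
  fixes L U :: "real set"
  assumes "finite L" "finite U" and less: "\<And>l u. l \<in> L \<Longrightarrow> u \<in> U \<Longrightarrow> l < u"
  shows "\<exists>r. (\<forall>l\<in>L. l < r) \<and> (\<forall>u\<in>U. r < u)"
proof (cases "L = {} \<or> U = {}")
  case True
  then show ?thesis
  proof
    assume "L = {}"
    moreover have "Min U - 1 < u" if "u \<in> U" for u using Min_le[OF assms(2) that] by simp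
    ultimately show ?thesis by blast
  next
    assume "U = {}"
    moreover have "l < Max L + 1" if "l \<in> L" for l using Max_ge[OF assms(1) that] by simp
    ultimately show ?thesis by blast
  qed
next
  case False
  then have "Max L < Min U" using assms by simp
  then obtain r where "Max L < r" "r < Min U" using dense by blast
  then have "\<forall>l\<in>L. l < r" "\<forall>u\<in>U. r < u" using assms(1,2) False by simp_all
  then show ?thesis by blast
qed

text \<open>
  The values \<open>x v\<close> are chosen greedily along a linear extension of the order. The bound 2 on
  comparable vertices with a common neighbour, which may be inserted later than both, keeps
  the constraints on the next value consistent.
\<close>

lemma two_chains_distance_embedding:
  fixes lt :: "'a \<Rightarrow> 'a \<Rightarrow> bool" and h :: "'a \<Rightarrow> real" and s :: "'a \<Rightarrow> bool"
  assumes "finite V"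
    and trans: "\<And>u v w. lt u v \<Longrightarrow> lt v w \<Longrightarrow> lt u w"
    and height: "\<And>u v. lt u v \<Longrightarrow> h u < h v"
    and chain: "\<And>u v. u \<in> V \<Longrightarrow> v \<in> V \<Longrightarrow> u \<noteq> v \<Longrightarrow> s u = s v \<Longrightarrow> lt u v \<or> lt v u"
  obtains x :: "'a \<Rightarrow> real" where "\<And>u v. u \<in> V \<Longrightarrow> v \<in> V \<Longrightarrow> s u \<noteq> s v \<Longrightarrow>
    \<bar>x u - x v\<bar> \<le> 1 \<longleftrightarrow> \<not> lt u v \<and> \<not> lt v u"
proof -
  define inc where "inc u v \<longleftrightarrow> s u \<noteq> s v \<and> \<not> lt u v \<and> \<not> lt v u" for u v
  define near where "near u v \<longleftrightarrow> (\<exists>z\<in>V. inc u z \<and> inc v z)" for u v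
  \<comment> \<open>All inequalities are strict, so that each new value can be chosen from an open
    interval. As \<open>ok\<close> is required for both orders of a pair, its third clause becomes a
    two-sided bound.\<close>
  define ok where "ok x u v \<longleftrightarrow> (s u = s v \<longrightarrow> lt u v \<longrightarrow> x u < x v) \<and> (s u \<noteq> s v \<longrightarrow> lt u v \<longrightarrow> x u + 1 < x v) \<and>
    (inc u v \<longrightarrow> x v < x u + 1) \<and> (s u = s v \<longrightarrow> lt u v \<longrightarrow> near u v \<longrightarrow> x v < x u + 2)"
    for x :: "'a \<Rightarrow> real" and u v
  have irrefl: "\<not> lt u u" for u using height by blast
  \<comment> \<open>Induction over down-closed sets, inserting a vertex of largest \<open>h\<close>;
    \<open>near\<close> refers to all of \<open>V\<close>, including vertices not yet
    placed.\<close>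
  have "S \<subseteq> V \<Longrightarrow> (\<forall>u\<in>S. \<forall>z\<in>V. lt z u \<longrightarrow> z \<in> S) \<Longrightarrow> \<exists>x. \<forall>u\<in>S. \<forall>v\<in>S. ok x u v"
    if "finite S" for S
    using that
  proof (induction rule: finite_ranking_induct[where f = h])
    case empty
    then show ?case by simp
  next
    case (insert v S)
    show ?case
    proof (cases "v \<in> S")
      case True
      then show ?thesis using insert.IH insert.prems by (simp add: insert_absorb)
    next
      case False
      have S: "S \<subseteq> V" and v: "v \<in> V" using insert.prems by auto
      have not_above: "\<not> lt v u" if "u \<in> S" for u
        using insert.hyps(2)[OF that] height by fastforce
      have down: "z \<in> S" if "u \<in> S" "z \<in> V" "lt z u" for u z
        using insert.prems that not_above by blast
      then obtain x where x: "\<And>u w. u \<in> S \<Longrightarrow> w \<in> S \<Longrightarrow> ok x u w"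
        using insert.IH S by blast
      have same: "x u < x w" if "u \<in> S" "w \<in> S" "s u = s w" "lt u w" for u w
        using x that by (simp add: ok_def)
      have far: "x u + 1 < x w" if "u \<in> S" "w \<in> S" "s u \<noteq> s w" "lt u w" for u w
        using x that by (simp add: ok_def)
      have adj: "x w < x u + 1" if "u \<in> S" "w \<in> S" "inc u w" for u w
        using x that by (simp add: ok_def)
      have dist2: "x w < x u + 2" if "u \<in> S" "w \<in> S" "s u = s w" "lt u w" "near u w" for u w
        using x that by (simp add: ok_def)
      have below: "lt w v" if "w \<in> S" "s w = s v" for w
        using chain[of w v] that not_above S v False by blast
      \<comment> \<open>Either \<open>u\<close> is below \<open>w\<close> and \<open>x u\<close> is
        smaller by more than 1, or the two are incomparable and closer than 1.\<close>
      have one: "x u < x w + 1" if "u \<in> S" "w \<in> S" "s u \<noteq> s w" "\<not> lt w u" for u w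
        using far[of u w] adj[of w u] that by (cases "lt u w") (auto simp: inc_def)
      \<comment> \<open>These sets are the sources of constraints on the new value \<open>r\<close>:
        it lies above \<open>Same\<close>, more than 1 above \<open>Below\<close>, within 1 of
        \<open>Adj\<close> and less than 2 above \<open>Near\<close>. The claims \<open>up1\<close>
        to \<open>up6\<close> compare every lower with every upper bound.\<close>
      define Same where "Same = {w \<in> S. s w = s v}"
      define Below where "Below = {u \<in> S. s u \<noteq> s v \<and> lt u v}"
      define Adj where "Adj = {u \<in> S. inc u v}"
      define Near where "Near = {w \<in> S. s w = s v \<and> near w v}"
      have up1: "x w < x u + 1" if "w \<in> Same" "u \<in> Adj" for w u
      proof (rule one)
        show "\<not> lt u w"
          using that below[of w] trans[of u w v] by (auto simp: Same_def Adj_def inc_def)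
      qed (use that in \<open>auto simp: Same_def Adj_def inc_def\<close>)
      have up2: "x u + 1 < x u' + 1" if "u \<in> Below" "u' \<in> Adj" for u u'
      proof -
        have "u \<noteq> u'" "\<not> lt u' u" "s u = s u'"
          using that trans[of u' u v] by (auto simp: Below_def Adj_def inc_def)
        then have "lt u u'" using that chain[of u u'] S by (auto simp: Below_def Adj_def)
        then show ?thesis using same[of u u'] that \<open>s u = s u'\<close> by (auto simp: Below_def Adj_def)
      qed
      \<comment> \<open>The new vertex \<open>v\<close> is itself a common neighbour of
        \<open>u\<close> and \<open>u'\<close>, so the bound 2 applies to them.\<close>
      have up3: "x u - 1 < x u' + 1" if "u \<in> Adj" "u' \<in> Adj" for u u'
      proof -
        have su: "s u = s u'" "near u' u" "u \<in> S" "u' \<in> S"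
          using that v by (auto simp: Adj_def inc_def near_def)
        then consider "u = u'" | "lt u u'" | "lt u' u" using chain[of u u'] S by blast
        then show ?thesis using same[of u u'] dist2[of u' u] su by cases auto
      qed
      have up4: "x w' < x w + 2" if "w' \<in> Same" "w \<in> Near" for w' w
      proof -
        have w: "w \<in> S" "w' \<in> S" "s w = s v" "s w' = s v"
          using that by (auto simp: Same_def Near_def)
        have nr: "near w v" using that by (simp add: Near_def)
        obtain z where z: "z \<in> V" "inc w z" "inc v z" using nr unfolding near_def by blast
        consider "w = w'" | "lt w' w" | "lt w w'" using chain[of w w'] S w by blast
        then show ?thesis
        proof cases
          case 3
          \<comment> \<open>Since \<open>w'\<close> lies between \<open>w\<close> and
            \<open>v\<close> in their chain, a common neighbour \<open>z\<close> of those two is a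
            neighbour of \<open>w'\<close> as well.\<close>
          have "\<not> lt w' z" "\<not> lt z w'"
            using z 3 below[of w'] w trans[of w w' z] trans[of z w' v] by (auto simp: inc_def)
          then have "near w w'" using z w by (auto simp: near_def inc_def)
          then show ?thesis using dist2[of w w'] w 3 by simp
        qed (use same[of w' w] w in auto)
      qed
      \<comment> \<open>It suffices that \<open>w\<close> is not below \<open>u\<close>: the common
        neighbour \<open>z\<close> of \<open>w\<close> and \<open>v\<close> lies above
        \<open>u\<close> and is incomparable to \<open>w\<close>.\<close>
      have up5: "x u + 1 < x w + 2" if "u \<in> Below" "w \<in> Near" for u w
      proof -
        have w: "w \<in> S" "s w = s v" and u: "u \<in> S" "s u \<noteq> s v" "lt u v"
          using that by (auto simp: Below_def Near_def)
        have nr: "near w v" using that by (simp add: Near_def)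
        obtain z where z: "z \<in> V" "inc w z" "inc v z" using nr unfolding near_def by blast
        have "u \<noteq> z" "\<not> lt z u" "s u = s z" using z u trans[of z u v] by (auto simp: inc_def)
        then have "lt u z" using chain[of u z] S u z by blast
        then have "\<not> lt w u" using trans[of w u z] z by (auto simp: inc_def)
        then show ?thesis using one[of u w] u w by simp
      qed
      have up6: "x u - 1 < x w + 2" if "u \<in> Adj" "w \<in> Near" for u w
      proof -
        have w: "w \<in> S" "s w = s v" and u: "u \<in> S" "s u \<noteq> s v" "inc u v"
          using that by (auto simp: Adj_def Near_def inc_def)
        have nr: "near w v" using that by (simp add: Near_def)
        obtain z where z: "z \<in> V" "inc w z" "inc v z" using nr unfolding near_def by blast
        have su: "s u = s z" using z u by (auto simp: inc_def)
        then consider "u = z" | "lt u z" | "lt z u" using chain[of u z] S u z by blast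
        then show ?thesis
        proof cases
          case 1
          then show ?thesis using adj[of w u] w u z by simp
        next
          case 2
          then have "\<not> lt w u" using trans[of w u z] z by (auto simp: inc_def)
          then show ?thesis using one[of u w] u w by simp
        next
          case 3
          \<comment> \<open>Here \<open>z\<close> is already placed, because the placed vertices are
            down-closed; the bounds 1 from \<open>w\<close> to \<open>z\<close> and 2 from
            \<open>z\<close> to \<open>u\<close> add up to 3.\<close>
          then have zS: "z \<in> S" using down[of u z] u z by simp
          have "inc z v" using z by (auto simp: inc_def)
          then have "near z u" using v u unfolding near_def by blast
          then have "x u < x z + 2" using dist2[of z u] 3 zS u su by simp
          moreover have "x z < x w + 1" using adj[of w z] w z zS by simp
          ultimately show ?thesis by simp
        qed
      qed
      define L where "L = x ` Same \<union> (\<lambda>u. x u + 1) ` Below \<union> (\<lambda>u. x u - 1) ` Adj"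
      define U where "U = (\<lambda>u. x u + 1) ` Adj \<union> (\<lambda>w. x w + 2) ` Near"
      have fin: "finite L" "finite U"
        using \<open>finite S\<close> by (simp_all add: L_def U_def Same_def Below_def Adj_def Near_def)
      have "l < u" if "l \<in> L" "u \<in> U" for l u
        using that unfolding L_def U_def
        by (elim UnE imageE) (simp_all only: up1 up2 up3 up4 up5 up6)
      from finite_sets_separation[OF fin this] obtain r where "\<forall>l\<in>L. l < r" "\<forall>u\<in>U. r < u"
        by blast
      then have r: "u \<in> Same \<Longrightarrow> x u < r" "u \<in> Below \<Longrightarrow> x u + 1 < r" "u \<in> Adj \<Longrightarrow> x u - 1 < r"
        "u \<in> Adj \<Longrightarrow> r < x u + 1" "u \<in> Near \<Longrightarrow> r < x u + 2" for u
        unfolding L_def U_def by blast+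
      let ?x = "x(v := r)"
      have "ok ?x u w" if uw: "u \<in> insert v S" "w \<in> insert v S" for u w
      proof -
        consider "u = v" "w = v" | "u \<in> S" "w \<in> S" | "u \<in> S" "w = v" | "u = v" "w \<in> S"
          using uw by blast
        then show ?thesis
        proof cases
          case 1
          then show ?thesis using irrefl by (simp add: ok_def inc_def)
        next
          case 2
          then show ?thesis using x[of u w] False by (auto simp: ok_def)
        next
          case 3
          then show ?thesis
            using False r[of u] by (auto simp: ok_def Same_def Below_def Adj_def Near_def)
        next
          case 4
          \<comment> \<open>As \<open>v\<close> is not below \<open>w\<close>, only the bound for
            incomparable pairs is at stake.\<close>
          have "inc w v" if "inc v w" using that by (auto simp: inc_def)
          then show ?thesis
            using 4 False r(3)[of w] not_above[of w] by (auto simp: ok_def Adj_def)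
        qed
      qed
      then show ?thesis by blast
    qed
  qed
  then obtain x where x: "\<And>u v. u \<in> V \<Longrightarrow> v \<in> V \<Longrightarrow> ok x u v"
    using \<open>finite V\<close> by (metis order_refl)
  have "\<bar>x u - x v\<bar> \<le> 1 \<longleftrightarrow> \<not> lt u v \<and> \<not> lt v u" if "u \<in> V" "v \<in> V" "s u \<noteq> s v" for u v
    using x[OF that(1,2)] x[OF that(2,1)] that(3) by (cases "inc u v") (auto simp: ok_def inc_def)
  then show thesis by (rule that)
qed

section \<open>The order behind a permutation graph\<close>

text \<open>A common point lies at the same fraction \<open>t\<close> of both segments. There the
  offset along \<open>d\<close> is affine in \<open>t\<close> with end values \<open>a - a'\<close>
  and \<open>b - b'\<close>, so it vanishes somewhere unless both values have the same strict
  sign.\<close>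

lemma segments_between_parallel_lines_meet:
  fixes p q d :: "real \<times> real" and a b a' b' :: real
  assumes d: "d \<noteq> 0" and q: "\<And>t. q \<noteq> p + t *\<^sub>R d"
  shows "closed_segment (p + a *\<^sub>R d) (q + b *\<^sub>R d) \<inter> closed_segment (p + a' *\<^sub>R d) (q + b' *\<^sub>R d) \<noteq> {} \<longleftrightarrow>
    \<not> (a < a' \<and> b < b') \<and> \<not> (a' < a \<and> b' < b)"
proof -
  define f where "f a b t = (1 - t) *\<^sub>R (p + a *\<^sub>R d) + t *\<^sub>R (q + b *\<^sub>R d)" for a b t :: real
  have f_eq: "f a b t = p + t *\<^sub>R (q - p) + ((1 - t) * a + t * b) *\<^sub>R d" for a b t
    by (simp add: f_def algebra_simps)
  have inj: "t = t' \<and> (1 - t) * a + t * b = (1 - t') * a' + t' * b'"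
    if eq: "f a b t = f a' b' t'" for t t'
  proof -
    define c where "c = ((1 - t') * a' + t' * b') - ((1 - t) * a + t * b)"
    have *: "(t - t') *\<^sub>R (q - p) = c *\<^sub>R d"
      using eq unfolding f_eq c_def by (simp add: algebra_simps)
    \<comment> \<open>Otherwise \<open>q - p\<close> would be a multiple of \<open>d\<close>, and
      the lines would coincide.\<close>
    have "t = t'"
    proof (rule ccontr)
      assume "t \<noteq> t'"
      then have "q - p = (c / (t - t')) *\<^sub>R d"
        using arg_cong[OF *, of "\<lambda>v. (1 / (t - t')) *\<^sub>R v"] by simp
      then have "q = p + (c / (t - t')) *\<^sub>R d" by (simp add: algebra_simps)
      then show False using q by blast
    qed
    then show ?thesis using * d by (simp add: c_def)
  qed
  have seg: "closed_segment (p + a *\<^sub>R d) (q + b *\<^sub>R d) = f a b ` {0..1}" for a b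
    by (auto simp: closed_segment_def f_def image_iff)
  have "closed_segment (p + a *\<^sub>R d) (q + b *\<^sub>R d) \<inter> closed_segment (p + a' *\<^sub>R d) (q + b' *\<^sub>R d) \<noteq> {} \<longleftrightarrow>
      (\<exists>t\<in>{0..1}. \<exists>t'\<in>{0..1}. f a b t = f a' b' t')"
    unfolding seg by blast
  also have "\<dots> \<longleftrightarrow> (\<exists>t\<in>{0..1}. f a b t = f a' b' t)"
    using inj by metis
  also have "\<dots> \<longleftrightarrow> (\<exists>t\<in>{0..1}. (1 - t) * (a - a') + t * (b - b') = 0)"
  proof (intro bex_cong refl)
    fix t :: real
    have "f a b t = f a' b' t \<longleftrightarrow> (1 - t) * a + t * b = (1 - t) * a' + t * b'"
      using d by (simp add: f_eq)
    also have "\<dots> \<longleftrightarrow> (1 - t) * (a - a') + t * (b - b') = 0"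
      by (subst eq_iff_diff_eq_0) (simp add: algebra_simps)
    finally show "f a b t = f a' b' t \<longleftrightarrow> (1 - t) * (a - a') + t * (b - b') = 0" .
  qed
  also have "\<dots> \<longleftrightarrow> \<not> (a < a' \<and> b < b') \<and> \<not> (a' < a \<and> b' < b)"
  proof
    assume "\<exists>t\<in>{0..1}. (1 - t) * (a - a') + t * (b - b') = 0"
    then obtain t where t: "0 \<le> t" "t \<le> 1" "(1 - t) * (a - a') + t * (b - b') = 0" by auto
    have pos: "(1 - t) * c + t * e > 0" if "c > 0" "e > 0" for c e
    proof (cases "t = 0")
      case False
      then have "t * e > 0" using t that by simp
      moreover have "(1 - t) * c \<ge> 0" using t that by simp
      ultimately show ?thesis by linarith
    qed (use that in simp)
    have "(1 - t) * (a' - a) + t * (b' - b) = - ((1 - t) * (a - a') + t * (b - b'))"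
      by (simp add: algebra_simps)
    then show "\<not> (a < a' \<and> b < b') \<and> \<not> (a' < a \<and> b' < b)"
      using pos[of "a - a'" "b - b'"] pos[of "a' - a" "b' - b"] t(3) by linarith
  next
    assume cross: "\<not> (a < a' \<and> b < b') \<and> \<not> (a' < a \<and> b' < b)"
    define c e where "c = a - a'" and "e = b - b'"
    have "\<exists>t\<in>{0..1}. (1 - t) * c + t * e = 0"
    proof (cases "c = e")
      case True
      then have "c = 0" using cross unfolding c_def e_def by linarith
      then show ?thesis by (intro bexI[of _ 0]) auto
    next
      case False
      then consider "c < e" "c \<le> 0" "0 \<le> e" | "e < c" "e \<le> 0" "0 \<le> c"
        using cross unfolding c_def e_def by linarith
      \<comment> \<open>The zero of the affine function with value \<open>c\<close> at 0 and
        \<open>e\<close> at 1.\<close>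
      then have "c / (c - e) \<in> {0..1}"
        by cases (simp_all add: zero_le_divide_iff divide_le_eq)
      moreover have "(1 - c / (c - e)) * c + c / (c - e) * e = 0"
        using False by (simp add: field_simps)
      ultimately show ?thesis by blast
    qed
    then show "\<exists>t\<in>{0..1}. (1 - t) * (a - a') + t * (b - b') = 0" by (simp add: c_def e_def)
  qed
  finally show ?thesis .
qed

text \<open>Disjoint segments are comparable by lying to the left of one another on both lines. Each
  side of the bipartition is independent, hence a chain, and adjacency across the sides is
  incomparability.\<close>

lemma bipartite_permutation_graph_distance:
  fixes G :: "('a, 'b) pre_digraph"
  assumes "bipartite_permutation_graph G"
  shows "\<exists>(x :: 'a \<Rightarrow> real) s :: 'a \<Rightarrow> bool. \<forall>u\<in>verts G. \<forall>v\<in>verts G.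
      u \<rightarrow>\<^bsub>G\<^esub> v \<longleftrightarrow> u \<noteq> v \<and> s u \<noteq> s v \<and> \<bar>x u - x v\<bar> \<le> 1"
proof -
  obtain p q d a b where G: "graph G" and d: "d \<noteq> 0" and q: "\<forall>t. q \<noteq> p + t *\<^sub>R d"
    and model: "intersection_model G (\<lambda>v. closed_segment (p + a v *\<^sub>R d) (q + b v *\<^sub>R d) :: (real \<times> real) set)"
    using assms by (auto simp: bipartite_permutation_graph_def permutation_graph_def)
  interpret graph G by (rule G)
  obtain A B where AB: "verts G = A \<union> B" "A \<inter> B = {}"
    "\<And>u v. u \<rightarrow>\<^bsub>G\<^esub> v \<Longrightarrow> (u \<in> A \<and> v \<in> B) \<or> (u \<in> B \<and> v \<in> A)"
    using assms by (auto simp: bipartite_permutation_graph_def bipartite_def)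
  define lt where "lt u v \<longleftrightarrow> a u < a v \<and> b u < b v" for u v
  define s where "s v \<longleftrightarrow> v \<in> A" for v
  have adj: "u \<rightarrow>\<^bsub>G\<^esub> v \<longleftrightarrow> \<not> lt u v \<and> \<not> lt v u" if "u \<in> verts G" "v \<in> verts G" "u \<noteq> v" for u v
    using model that segments_between_parallel_lines_meet[OF d, of q p "a u" "b u" "a v" "b v"] q
    by (simp add: intersection_model_def lt_def)
  have sides: "s u \<noteq> s v" if "u \<rightarrow>\<^bsub>G\<^esub> v" for u v
    using AB(2) AB(3)[OF that] by (auto simp: s_def)
  obtain x :: "'a \<Rightarrow> real" where x: "\<And>u v. u \<in> verts G \<Longrightarrow> v \<in> verts G \<Longrightarrow> s u \<noteq> s v \<Longrightarrow>
      \<bar>x u - x v\<bar> \<le> 1 \<longleftrightarrow> \<not> lt u v \<and> \<not> lt v u"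
  \<comment> \<open>The endpoint \<open>a\<close> on the first line serves as the height.\<close>
  proof (rule two_chains_distance_embedding[of "verts G" lt a s])
    show "lt u v \<or> lt v u" if "u \<in> verts G" "v \<in> verts G" "u \<noteq> v" "s u = s v" for u v
      using adj[OF that(1,2,3)] sides[of u v] that(4) by blast
  qed (auto simp: lt_def)
  have "u \<rightarrow>\<^bsub>G\<^esub> v \<longleftrightarrow> u \<noteq> v \<and> s u \<noteq> s v \<and> \<bar>x u - x v\<bar> \<le> 1"
    if "u \<in> verts G" "v \<in> verts G" for u v
    using adj[of u v] sides[of u v] x[of u v] that by (cases "u = v") auto
  then show ?thesis by (intro exI[of _ x] exI[of _ s] ballI)
qed

theorem theorem5:
  shows "admits_low_rank_width_colorings {G :: ('a, 'b) pre_digraph. unit_interval_graph G} \<and>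
         admits_low_rank_width_colorings {G :: ('a, 'b) pre_digraph. bipartite_permutation_graph G}"
proof
  show "admits_low_rank_width_colorings {G :: ('a, 'b) pre_digraph. unit_interval_graph G}"
  proof (rule admits_low_rank_width_colorings_distance_graphs)
    fix G :: "('a, 'b) pre_digraph"
    assume "G \<in> {G. unit_interval_graph G}"
    then have G: "unit_interval_graph G" by simp
    then have "graph G" unfolding unit_interval_graph_def by blast
    then interpret graph G .
    obtain x :: "'a \<Rightarrow> real" where x: "\<forall>u\<in>verts G. \<forall>v\<in>verts G.
        u \<rightarrow>\<^bsub>G\<^esub> v \<longleftrightarrow> u \<noteq> v \<and> \<bar>x u - x v\<bar> \<le> 1"
      using unit_interval_graph_distance[OF G] by blast
    \<comment> \<open>With \<open>joins\<close> constantly true, the side function may be left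
      arbitrary.\<close>
    show "finite (verts G) \<and> (\<exists>(x :: 'a \<Rightarrow> real) (s :: 'a \<Rightarrow> bool) joins.
      \<forall>u\<in>verts G. \<forall>v\<in>verts G.
        u \<rightarrow>\<^bsub>G\<^esub> v \<longleftrightarrow> u \<noteq> v \<and> joins (s u) (s v) \<and> \<bar>x u - x v\<bar> \<le> 1)"
      by (rule conjI[OF finite_verts], rule exI[of _ x], rule exI, rule exI[of _ "\<lambda>_ _. True"]) (simp add: x)
  qed
  show "admits_low_rank_width_colorings {G :: ('a, 'b) pre_digraph. bipartite_permutation_graph G}"
  proof (rule admits_low_rank_width_colorings_distance_graphs)
    fix G :: "('a, 'b) pre_digraph"
    assume "G \<in> {G. bipartite_permutation_graph G}"
    then have G: "bipartite_permutation_graph G" by simp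
    then have "graph G" unfolding bipartite_permutation_graph_def permutation_graph_def by blast
    then interpret graph G .
    obtain x :: "'a \<Rightarrow> real" and s :: "'a \<Rightarrow> bool" where x: "\<forall>u\<in>verts G. \<forall>v\<in>verts G.
        u \<rightarrow>\<^bsub>G\<^esub> v \<longleftrightarrow> u \<noteq> v \<and> s u \<noteq> s v \<and> \<bar>x u - x v\<bar> \<le> 1"
      using bipartite_permutation_graph_distance[OF G] by blast
    show "finite (verts G) \<and> (\<exists>(x :: 'a \<Rightarrow> real) (s :: 'a \<Rightarrow> bool) joins.
      \<forall>u\<in>verts G. \<forall>v\<in>verts G.
        u \<rightarrow>\<^bsub>G\<^esub> v \<longleftrightarrow> u \<noteq> v \<and> joins (s u) (s v) \<and> \<bar>x u - x v\<bar> \<le> 1)"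
      by (rule conjI[OF finite_verts], rule exI[of _ x], rule exI[of _ s], rule exI[of _ "(\<noteq>)"]) (fact x)
  qed
qed

end
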